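(* Consider the \textsc{Max} problem in the noisy value model. There exists a set of $n$ elements $X$ such that for any algorithm $A$ and any $b\ge 4$ the following holds: if $A$ returns the maximum of $X$ with correctness probability at least $2/3$ in $r$ rounds using at most $q=n\log_3(b)$ value queries, then $r\ge \log_b^*(n)-O(1)$.
   Context: Noisy value model: each of the $n$ elements has a value; to answer a query about element $i$, the oracle with probability $2/3$ returns the true value of $i$ and with the remaining probability returns an arbitrary (adversarially chosen) value. An algorithm uses $r$ rounds if its queries can be partitioned into $r$ batches, the queries of each batch depending only on answers to previous batches. For $b>1$, $\log_b^*(n)$ is the least integer $i$ such that $a_i\le 0$ in the sequence $a_0=n$, $a_{j+1}=\log_b a_j$. The $O(1)$ denotes an absolute constant. *)

theory Defs
  imports "HOL-Probability.Probability" "HOL-Combinatorics.Permutations"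
begin

text \<open>One inner list per round, recording that round's queries with their answers.\<close>

type_synonym transcript = "(nat \<times> real) list list"

text \<open>
  A randomised algorithm in behavioural form: it draws the next batch of queries, and finally its
  output, at random given the transcript so far. The transcript records all queries and answers, so
  private randomness kept from one round to the next adds no power (perfect recall). A batch may
  query the same element several times.
\<close>

record value_alg =
  next_batch :: "transcript \<Rightarrow> nat list pmf"
  result :: "transcript \<Rightarrow> nat pmf"

definition alg_on :: "nat \<Rightarrow> value_alg \<Rightarrow> bool" where
  "alg_on n A \<longleftrightarrow> (\<forall>h. \<forall>qs \<in> set_pmf (next_batch A h). set qs \<subseteq> {..<n})"

text \<open>
  An adversary supplies the value returned when the oracle does not tell the truth. Its choice may
  depend on the transcript of the earlier rounds, on the whole current batch, on which queries of the
  batch are answered truthfully (\<open>True\<close>), and on the position of the query in the batch. The supplied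
  value is arbitrary and may coincide with the true one. Since adversaries are quantified after the
  algorithm and the value assignment, they may depend on these too.
\<close>

type_synonym adversary = "transcript \<Rightarrow> nat list \<Rightarrow> bool list \<Rightarrow> nat \<Rightarrow> real"

definition noisy_answers ::
    "(nat \<Rightarrow> real) \<Rightarrow> (nat list \<Rightarrow> bool list \<Rightarrow> nat \<Rightarrow> real) \<Rightarrow> nat list \<Rightarrow> (nat \<times> real) list pmf" where
  "noisy_answers v f qs =
     map_pmf (\<lambda>cs. map (\<lambda>j. (qs ! j, if cs ! j then v (qs ! j) else f qs cs j)) [0..<length qs])
       (replicate_pmf (length qs) (bernoulli_pmf (2/3)))"

primrec run :: "value_alg \<Rightarrow> (nat \<Rightarrow> real) \<Rightarrow> adversary \<Rightarrow> nat \<Rightarrow> transcript pmf" where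
  "run A v adv 0 = return_pmf []"
| "run A v adv (Suc r) =
     bind_pmf (run A v adv r) (\<lambda>h.
     bind_pmf (next_batch A h) (\<lambda>qs.
     map_pmf (\<lambda>ans. h @ [ans]) (noisy_answers v (adv h) qs)))"

definition max_elements :: "nat \<Rightarrow> (nat \<Rightarrow> real) \<Rightarrow> nat set" where
  "max_elements n v = {i. i < n \<and> v i = Max (v ` {..<n})}"

text \<open>
  The values \<open>x 0, \<dots>, x (n - 1)\<close> of the instance are fixed, but the algorithm is not told which
  element carries which value: its guarantees have to hold for every arrangement \<open>x \<circ> \<pi>\<close> of these
  values and for every adversary. (For a single known arrangement the constant answer would be
  correct without any query.)
\<close>

definition solves_max :: "nat \<Rightarrow> (nat \<Rightarrow> real) \<Rightarrow> nat \<Rightarrow> real \<Rightarrow> value_alg \<Rightarrow> bool" where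
  "solves_max n x r p A \<longleftrightarrow>
     (\<forall>\<pi> adv. \<pi> permutes {..<n} \<longrightarrow>
        measure_pmf.prob (bind_pmf (run A (x \<circ> \<pi>) adv r) (result A)) (max_elements n (x \<circ> \<pi>)) \<ge> p)"

definition uses_at_most :: "nat \<Rightarrow> (nat \<Rightarrow> real) \<Rightarrow> nat \<Rightarrow> real \<Rightarrow> value_alg \<Rightarrow> bool" where
  "uses_at_most n x r q A \<longleftrightarrow>
     (\<forall>\<pi> adv. \<pi> permutes {..<n} \<longrightarrow>
        (\<forall>h \<in> set_pmf (run A (x \<circ> \<pi>) adv r). real (length (concat h)) \<le> q))"

definition log_star :: "real \<Rightarrow> real \<Rightarrow> nat" where
  "log_star b a = (LEAST i. (log b ^^ i) a \<le> 0)"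

end

theory Submission
  imports Defs
begin

text \<open>
  Take one element of value 1 at a uniformly random place \<open>M\<close>, all others having value 0, and let the
  adversary always lie by saying 1. If \<open>k m\<close> is the number of queries to \<open>m\<close>, a transcript is at most
  \<open>3 ^ k m\<close> times as likely when \<open>M = m\<close> as when all values are 0. Hence, as long as \<open>k M \<le> K\<close>, the
  algorithm knows \<open>M\<close> only up to a factor \<open>3 ^ K\<close> from uniform: by Markov's inequality the next batch
  raises \<open>k M\<close> above \<open>K'\<close> with probability at most \<open>3 ^ K * (q / n) / K'\<close>, and the output is \<open>M\<close>
  with probability at most \<open>3 ^ K / n\<close>. Choosing \<open>K' = 12 * 2 ^ i * 3 ^ K * (q / n)\<close> in round \<open>i\<close>
  keeps the total failure probability below 1/6, so \<open>3 ^ K\<close> must reach the order of \<open>n\<close> within \<open>r\<close>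
  rounds, while \<open>K\<close> grows like a tower of \<open>b\<close>s.
\<close>

section \<open>Pointwise domination of discrete distributions\<close>

text \<open>Everything is stated at one outcome \<open>z\<close>, so \<open>c\<close> may depend on
  \<open>z\<close>. This is essential later, where the factor is a power of 3 read off the
  transcript.\<close>

lemma pmf_bind_dominated:
  assumes "\<And>x. pmf P x * pmf (F x) z \<le> c * (pmf Q x * pmf (G x) z)" and "c \<ge> 0"
  shows "pmf (bind_pmf P F) z \<le> c * pmf (bind_pmf Q G) z"
proof -
  have "ennreal (pmf (bind_pmf P F) z)
      = (\<integral>\<^sup>+x. ennreal (pmf P x) * ennreal (pmf (F x) z) \<partial>count_space UNIV)"
    by (simp add: ennreal_pmf_bind nn_integral_measure_pmf)
  also have "\<dots> \<le> (\<integral>\<^sup>+x. ennreal c * (ennreal (pmf Q x) * ennreal (pmf (G x) z)) \<partial>count_space UNIV)"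
    using assms by (intro nn_integral_mono) (simp flip: ennreal_mult add: ennreal_leI)
  also have "\<dots> = ennreal c * (\<integral>\<^sup>+x. ennreal (pmf Q x) * ennreal (pmf (G x) z) \<partial>count_space UNIV)"
    by (simp add: nn_integral_cmult)
  also have "\<dots> = ennreal (c * pmf (bind_pmf Q G) z)"
    using assms(2) by (simp add: ennreal_pmf_bind nn_integral_measure_pmf ennreal_mult)
  finally show ?thesis
    using assms(2) by (simp add: ennreal_le_iff)
qed

text \<open>By injectivity \<open>z\<close> has at most one preimage, so a comparison there
  suffices; without a preimage the left side is 0.\<close>

lemma pmf_map_dominated:
  assumes "inj f" and "\<And>x. z = f x \<Longrightarrow> pmf P x \<le> c * pmf Q x" and "c \<ge> 0"
  shows "pmf (map_pmf f P) z \<le> c * pmf (map_pmf f Q) z"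
proof (cases "z \<in> range f")
  case True
  then show ?thesis using assms by (auto simp: pmf_map_inj')
next
  case False
  then have "pmf (map_pmf f P) z = 0"
    by (auto simp: pmf_eq_0_set_pmf)
  then show ?thesis using assms(3) by simp
qed

text \<open>Exchange the two sums: an outcome \<open>z\<close> contributes at most
  \<open>c * pmf Q z\<close> for each event containing it, hence at most
  \<open>c * d * pmf Q z\<close>, and \<open>Q\<close> has mass 1. The count \<open>few\<close> is
  demanded only on outcomes that can occur, because a query budget holds only there.\<close>

lemma sum_prob_le_of_dominated:
  fixes P :: "nat \<Rightarrow> 'a pmf" and Q :: "'a pmf" and c d :: real
  assumes dom: "\<And>m z. m < n \<Longrightarrow> z \<in> E m \<Longrightarrow> pmf (P m) z \<le> c * pmf Q z"
    and few: "\<And>m z. m < n \<Longrightarrow> z \<in> set_pmf (P m) \<Longrightarrow> real (card {l. l < n \<and> z \<in> E l}) \<le> d"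
    and "c \<ge> 0" "d \<ge> 0"
  shows "(\<Sum>m<n. measure_pmf.prob (P m) (E m)) \<le> c * d"
proof -
  have pt: "(\<Sum>m<n. pmf (P m) z * indicator (E m) z) \<le> c * d * pmf Q z" for z
  proof (cases "\<exists>m<n. z \<in> set_pmf (P m)")
    case True
    have "(\<Sum>m<n. pmf (P m) z * indicator (E m) z) \<le> (\<Sum>m<n. c * pmf Q z * indicator (E m) z)"
      using dom by (intro sum_mono) (auto simp: indicator_def)
    also have "\<dots> = c * pmf Q z * (\<Sum>m<n. indicator (E m) z)"
      by (simp add: sum_distrib_left)
    also have "(\<Sum>m<n. indicator (E m) z) = real (card {l. l < n \<and> z \<in> E l})"
    proof -
      have "(\<Sum>m<n. indicator (E m) z :: real) = (\<Sum>m\<in>{l. l < n \<and> z \<in> E l}. 1)"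
        by (intro sum.mono_neutral_cong_right) (auto simp: indicator_def)
      then show ?thesis by simp
    qed
    also have "c * pmf Q z * \<dots> \<le> c * pmf Q z * d"
      using few True \<open>c \<ge> 0\<close> by (intro mult_left_mono) auto
    finally show ?thesis by (simp add: mult_ac)
  next
    case False
    then have "(\<Sum>m<n. pmf (P m) z * indicator (E m) z) = 0"
      by (intro sum.neutral) (auto simp: set_pmf_iff)
    then show ?thesis using assms(3,4) by simp
  qed
  have "ennreal (\<Sum>m<n. measure_pmf.prob (P m) (E m)) = (\<Sum>m<n. emeasure (P m) (E m))"
    by (simp add: measure_pmf.emeasure_eq_measure sum_ennreal)
  also have "\<dots> = (\<Sum>m<n. \<integral>\<^sup>+z. ennreal (pmf (P m) z * indicator (E m) z) \<partial>count_space UNIV)"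
  proof (intro sum.cong refl)
    fix m
    have "emeasure (P m) (E m) = (\<integral>\<^sup>+z. indicator (E m) z \<partial>P m)"
      by simp
    also have "\<dots> = (\<integral>\<^sup>+z. ennreal (pmf (P m) z) * indicator (E m) z \<partial>count_space UNIV)"
      by (simp add: nn_integral_measure_pmf)
    also have "\<dots> = (\<integral>\<^sup>+z. ennreal (pmf (P m) z * indicator (E m) z) \<partial>count_space UNIV)"
      by (intro nn_integral_cong) (auto simp: indicator_def)
    finally show "emeasure (P m) (E m) = \<dots>" .
  qed
  also have "\<dots> = (\<integral>\<^sup>+z. (\<Sum>m<n. ennreal (pmf (P m) z * indicator (E m) z)) \<partial>count_space UNIV)"
    by (rule nn_integral_sum[symmetric]) simp
  also have "\<dots> \<le> (\<integral>\<^sup>+z. ennreal (c * d) * ennreal (pmf Q z) \<partial>count_space UNIV)"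
    using pt assms(3,4)
    by (intro nn_integral_mono) (simp add: sum_ennreal ennreal_leI flip: ennreal_mult)
  also have "\<dots> = ennreal (c * d)"
    by (simp add: nn_integral_cmult nn_integral_pmf)
  finally show ?thesis
    using assms(3,4) by (simp add: ennreal_le_iff)
qed

section \<open>Likelihood ratio of a transcript\<close>

lemma noisy_answers_Nil: "noisy_answers v f [] = return_pmf []"
  by (simp add: noisy_answers_def)

text \<open>With a constant lie each answer depends on its own coin only, so the answers are
  independent and a batch can be treated by induction.\<close>

lemma noisy_answers_const_Cons:
  "noisy_answers v (\<lambda>_ _ _. t) (q # qs) =
     bind_pmf (map_pmf (\<lambda>c. (q, if c then v q else t)) (bernoulli_pmf (2/3)))
       (\<lambda>a. map_pmf ((#) a) (noisy_answers v (\<lambda>_ _ _. t) qs))"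
proof -
  have upt: "[0..<Suc k] = 0 # map Suc [0..<k]" for k
    by (simp add: upt_conv_Cons map_Suc_upt del: upt_Suc)
  show ?thesis
    by (simp add: noisy_answers_def upt bind_map_pmf map_bind_pmf map_pmf_comp o_def
        bind_return_pmf' flip: map_pmf_def del: upt_Suc)
      (simp add: map_pmf_def bind_assoc_pmf bind_return_pmf upt o_def del: upt_Suc cong: if_cong)
qed

lemma map_fst_noisy_answers: "map_pmf (map fst) (noisy_answers v f qs) = return_pmf qs"
proof -
  have "map_pmf (map fst) (noisy_answers v f qs)
      = map_pmf (\<lambda>_. qs) (replicate_pmf (length qs) (bernoulli_pmf (2/3)))"
    by (simp add: noisy_answers_def map_pmf_comp o_def map_nth)
  then show ?thesis by simp
qed

definition spike :: "nat \<Rightarrow> nat \<Rightarrow> real" where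
  "spike m i = (if i = m then 1 else 0)"

abbreviation say_one :: "nat list \<Rightarrow> bool list \<Rightarrow> nat \<Rightarrow> real" where
  "say_one \<equiv> \<lambda>_ _ _. 1"

lemma pmf_noisy_answers_spike_le:
  "pmf (noisy_answers (spike m) say_one qs) ans
     \<le> 3 ^ count_list qs m * pmf (noisy_answers (\<lambda>_. 0) say_one qs) ans"
proof (induction qs arbitrary: ans)
  case Nil
  then show ?case by (simp add: noisy_answers_Nil)
next
  case (Cons q qs)
  define D where "D v = map_pmf (\<lambda>c. (q, if c then v q else 1::real)) (bernoulli_pmf (2/3))"
    for v :: "nat \<Rightarrow> real"
  have single: "pmf (D (spike m)) a \<le> (if q = m then 3 else 1) * pmf (D (\<lambda>_. 0)) a" for a
  proof (cases "q = m")
    case True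
    have "D (spike m) = return_pmf (q, 1)"
      using True by (simp add: D_def spike_def cong: if_cong)
    moreover have "pmf (D (\<lambda>_. 0)) (q, 1) = 1/3"
    proof -
      have "(\<lambda>c. (q, if c then 0 else 1::real)) -` {(q, 1)} = {False}"
        by (auto split: if_splits)
      then show ?thesis
        by (simp add: D_def pmf_map measure_pmf_single)
    qed
    ultimately show ?thesis using True by (auto simp: indicator_def)
  qed (simp add: D_def spike_def cong: if_cong)
  have "pmf (D (spike m)) x * pmf (map_pmf ((#) x) (noisy_answers (spike m) say_one qs)) ans
      \<le> 3 ^ count_list (q # qs) m * (pmf (D (\<lambda>_. 0)) x
          * pmf (map_pmf ((#) x) (noisy_answers (\<lambda>_. 0) say_one qs)) ans)" for x
  proof -
    have "pmf (map_pmf ((#) x) (noisy_answers (spike m) say_one qs)) ans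
        \<le> 3 ^ count_list qs m * pmf (map_pmf ((#) x) (noisy_answers (\<lambda>_. 0) say_one qs)) ans"
      using Cons.IH by (intro pmf_map_dominated) auto
    from mult_mono[OF single[of x] this] show ?thesis
      by (cases "q = m") (simp_all add: mult_ac)
  qed
  then have "pmf (bind_pmf (D (spike m)) (\<lambda>x. map_pmf ((#) x) (noisy_answers (spike m) say_one qs))) ans
      \<le> 3 ^ count_list (q # qs) m * pmf (bind_pmf (D (\<lambda>_. 0))
          (\<lambda>x. map_pmf ((#) x) (noisy_answers (\<lambda>_. 0) say_one qs))) ans"
    by (rule pmf_bind_dominated) simp
  then show ?case
    unfolding noisy_answers_const_Cons D_def .
qed

definition hits :: "nat \<Rightarrow> transcript \<Rightarrow> nat" where
  "hits m h = count_list (map fst (concat h)) m"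

abbreviation spike_run :: "value_alg \<Rightarrow> nat \<Rightarrow> nat \<Rightarrow> transcript pmf" where
  "spike_run A m \<equiv> run A (spike m) (\<lambda>_. say_one)"

abbreviation null_run :: "value_alg \<Rightarrow> nat \<Rightarrow> transcript pmf" where
  "null_run A \<equiv> run A (\<lambda>_. 0) (\<lambda>_. say_one)"

lemma set_noisy_answersD: "ans \<in> set_pmf (noisy_answers v f qs) \<Longrightarrow> map fst ans = qs"
  using map_fst_noisy_answers[of v f qs] by (metis imageI pmf.set_map set_return_pmf singletonD)

text \<open>
  An answer 1 about the maximum is certain, whereas it has probability 1/3 when all values are 0;
  all other answers have the same law in both cases.
\<close>

lemma pmf_spike_run_le: "pmf (spike_run A m r) h \<le> 3 ^ hits m h * pmf (null_run A r) h"
proof (induction r arbitrary: h)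
  case 0
  then show ?case by (auto simp: hits_def indicator_def)
next
  case (Suc r)
  define F where "F v h' qs = map_pmf (\<lambda>ans. h' @ [ans]) (noisy_answers v say_one qs)"
    for v and h' :: transcript and qs
  \<comment> \<open>The exponent is read off the last round of \<open>h\<close> instead of
    \<open>qs\<close>. The two agree on every answer list of positive probability, and the factor is
    then the same for all batches, as \<open>pmf_bind_dominated\<close> requires.\<close>
  have step: "pmf (F (spike m) h' qs) h \<le> 3 ^ count_list (map fst (last h)) m * pmf (F (\<lambda>_. 0) h' qs) h"
    for h' qs
  proof -
    have "pmf (noisy_answers (spike m) say_one qs) ans
        \<le> 3 ^ count_list (map fst ans) m * pmf (noisy_answers (\<lambda>_. 0) say_one qs) ans" for ans
    proof (cases "ans \<in> set_pmf (noisy_answers (spike m) say_one qs)")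
      case True
      then show ?thesis
        using pmf_noisy_answers_spike_le[of m qs ans] by (simp add: set_noisy_answersD)
    qed (simp add: set_pmf_iff)
    then show ?thesis
      unfolding F_def by (intro pmf_map_dominated) (auto simp: inj_def)
  qed
  have "pmf (spike_run A m r) h' * pmf (bind_pmf (next_batch A h') (F (spike m) h')) h
      \<le> 3 ^ hits m h * (pmf (null_run A r) h' * pmf (bind_pmf (next_batch A h') (F (\<lambda>_. 0) h')) h)"
    for h'
  proof (cases "\<exists>ans. h = h' @ [ans]")
    case True
    then have hits: "hits m h = hits m h' + count_list (map fst (last h)) m"
      by (auto simp: hits_def count_list_append)
    have "pmf (bind_pmf (next_batch A h') (F (spike m) h')) h
        \<le> 3 ^ count_list (map fst (last h)) m * pmf (bind_pmf (next_batch A h') (F (\<lambda>_. 0) h')) h"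
    proof (rule pmf_bind_dominated)
      fix qs
      show "pmf (next_batch A h') qs * pmf (F (spike m) h' qs) h
        \<le> 3 ^ count_list (map fst (last h)) m * (pmf (next_batch A h') qs * pmf (F (\<lambda>_. 0) h' qs) h)"
        using mult_left_mono[OF step[of h' qs], of "pmf (next_batch A h') qs"]
        by (simp add: mult_ac)
    qed simp
    from mult_mono[OF Suc.IH[of h'] this] show ?thesis
      by (simp add: hits power_add mult_ac)
  next
    case False
    then have "pmf (bind_pmf (next_batch A h') (F (spike m) h')) h = 0"
      by (auto simp: pmf_eq_0_set_pmf F_def)
    then show ?thesis by simp
  qed
  then have "pmf (bind_pmf (spike_run A m r) (\<lambda>h'. bind_pmf (next_batch A h') (F (spike m) h'))) h
     \<le> 3 ^ hits m h * pmf (bind_pmf (null_run A r) (\<lambda>h'. bind_pmf (next_batch A h') (F (\<lambda>_. 0) h'))) h"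
    by (rule pmf_bind_dominated) simp
  then show ?case
    by (simp add: F_def[abs_def])
qed

section \<open>One more random choice after a transcript\<close>

text \<open>The joint law of a transcript and the algorithm's next choice. Taking
  \<open>next_batch A\<close> or \<open>result A\<close> for \<kappa> lets one argument serve both
  the rounds and the final output.\<close>

definition with_next :: "transcript pmf \<Rightarrow> (transcript \<Rightarrow> 'b pmf) \<Rightarrow> (transcript \<times> 'b) pmf" where
  "with_next P \<kappa> = bind_pmf P (\<lambda>h. map_pmf (Pair h) (\<kappa> h))"

text \<open>A union bound, using that the first marginal is \<open>P\<close>. It isolates the
  transcripts with few hits, where the likelihood ratio is under control.\<close>

lemma prob_with_next_le_split:
  fixes K :: real
  shows "measure_pmf.prob (with_next P \<kappa>) S
    \<le> measure_pmf.prob P {h. K < real (hits m h)}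
      + measure_pmf.prob (with_next P \<kappa>) {(h, y). real (hits m h) \<le> K \<and> (h, y) \<in> S}"
proof -
  have fst: "P = map_pmf fst (with_next P \<kappa>)"
    by (simp add: with_next_def map_bind_pmf map_pmf_comp bind_return_pmf')
  have "measure_pmf.prob (with_next P \<kappa>) S \<le> measure_pmf.prob (with_next P \<kappa>)
      ({z. K < real (hits m (fst z))} \<union> {(h, y). real (hits m h) \<le> K \<and> (h, y) \<in> S})"
    by (intro measure_pmf.finite_measure_mono) auto
  also have "\<dots> \<le> measure_pmf.prob (with_next P \<kappa>) {z. K < real (hits m (fst z))}
      + measure_pmf.prob (with_next P \<kappa>) {(h, y). real (hits m h) \<le> K \<and> (h, y) \<in> S}"
    by (intro measure_Un_le) auto
  also have "measure_pmf.prob (with_next P \<kappa>) {z. K < real (hits m (fst z))}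
      = measure_pmf.prob P {h. K < real (hits m h)}"
    using arg_cong[OF fst, of "\<lambda>P. measure_pmf.prob P {h. K < real (hits m h)}"]
    by (simp add: vimage_def)
  finally show ?thesis .
qed

text \<open>The next choice sees only the transcript, not the place of the maximum, so it leaves the
  likelihood ratio unchanged.\<close>

lemma pmf_with_next_spike_le:
  "pmf (with_next (spike_run A m r) \<kappa>) (h, y) \<le> 3 ^ hits m h * pmf (with_next (null_run A r) \<kappa>) (h, y)"
  unfolding with_next_def
proof (rule pmf_bind_dominated)
  fix h'
  show "pmf (spike_run A m r) h' * pmf (map_pmf (Pair h') (\<kappa> h')) (h, y)
    \<le> 3 ^ hits m h * (pmf (null_run A r) h' * pmf (map_pmf (Pair h') (\<kappa> h')) (h, y))"
  proof (cases "h' = h")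
    case True
    then show ?thesis
      using mult_right_mono[OF pmf_spike_run_le[of A m r h], of "pmf (map_pmf (Pair h) (\<kappa> h)) (h, y)"]
      by (simp add: mult_ac)
  next
    case False
    then have "pmf (map_pmf (Pair h') (\<kappa> h')) (h, y) = 0"
      by (auto simp: pmf_eq_0_set_pmf)
    then show ?thesis by simp
  qed
qed simp

text \<open>With at most \<open>K\<close> hits the ratio is at most \<open>3 powr K\<close> for
  every \<open>m\<close>, so all positions are compared with the same null run. Here
  \<open>d\<close> bounds the number of positions for which one outcome counts.\<close>

lemma sum_prob_with_next_le:
  fixes K d :: real
  assumes few: "\<And>m h y. m < n \<Longrightarrow> (h, y) \<in> set_pmf (with_next (spike_run A m r) \<kappa>) \<Longrightarrow>
      real (card {l. l < n \<and> (h, y) \<in> S l}) \<le> d" and "d \<ge> 0"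
  shows "(\<Sum>m<n. measure_pmf.prob (with_next (spike_run A m r) \<kappa>)
      {(h, y). real (hits m h) \<le> K \<and> (h, y) \<in> S m}) \<le> 3 powr K * d"
proof (rule sum_prob_le_of_dominated)
  fix m and z :: "transcript \<times> 'a"
  assume "z \<in> {(h, y). real (hits m h) \<le> K \<and> (h, y) \<in> S m}"
  then obtain h y where z: "z = (h, y)" "real (hits m h) \<le> K" by auto
  have "(3::real) ^ hits m h = 3 powr real (hits m h)"
    by (simp add: powr_realpow)
  also have "\<dots> \<le> 3 powr K"
    using z by simp
  finally show "pmf (with_next (spike_run A m r) \<kappa>) z \<le> 3 powr K * pmf (with_next (null_run A r) \<kappa>) z"
    using pmf_with_next_spike_le[of A m r \<kappa> h y] unfolding z(1)
    by (meson mult_right_mono order_trans pmf_nonneg)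
next
  fix m and z :: "transcript \<times> 'a"
  assume m: "m < n" and z: "z \<in> set_pmf (with_next (spike_run A m r) \<kappa>)"
  have "card {l. l < n \<and> z \<in> {(h, y). real (hits l h) \<le> K \<and> (h, y) \<in> S l}}
      \<le> card {l. l < n \<and> z \<in> S l}"
    by (intro card_mono) auto
  then show "real (card {l. l < n \<and> z \<in> {(h, y). real (hits l h) \<le> K \<and> (h, y) \<in> S l}}) \<le> d"
    using few[OF m, of "fst z" "snd z"] z by simp
qed (use assms in auto)

section \<open>Growth of the number of hits over the rounds\<close>

text \<open>The batch alone fixes the new hit count, so the event is decided before the answers are
  drawn.\<close>

lemma prob_hits_Suc:
  "measure_pmf.prob (spike_run A m (Suc r)) {h. P (hits m h)} =
   measure_pmf.prob (with_next (spike_run A m r) (next_batch A))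
      {(h, qs). P (hits m h + count_list qs m)}"
proof -
  have inner: "map_pmf (\<lambda>ans. hits m (h @ [ans])) (noisy_answers v f qs)
      = return_pmf (hits m h + count_list qs m)" for h v f qs
  proof -
    have "map_pmf (\<lambda>ans. hits m (h @ [ans])) (noisy_answers v f qs)
        = map_pmf (\<lambda>l. hits m h + count_list l m) (map_pmf (map fst) (noisy_answers v f qs))"
      by (simp add: hits_def count_list_append map_pmf_comp)
    then show ?thesis by (simp add: map_fst_noisy_answers)
  qed
  have "map_pmf (hits m) (spike_run A m (Suc r)) =
      map_pmf (\<lambda>(h, qs). hits m h + count_list qs m) (with_next (spike_run A m r) (next_batch A))"
    by (simp add: with_next_def map_bind_pmf map_pmf_comp inner) (simp add: map_pmf_def)
  then have "measure_pmf.prob (map_pmf (hits m) (spike_run A m (Suc r))) {k. P k} =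
      measure_pmf.prob (map_pmf (\<lambda>(h, qs). hits m h + count_list qs m)
        (with_next (spike_run A m r) (next_batch A))) {k. P k}"
    by simp
  then show ?thesis
    by (simp add: vimage_def case_prod_unfold del: run.simps)
qed

lemma set_run_SucI:
  assumes "h \<in> set_pmf (run A v adv r)" "qs \<in> set_pmf (next_batch A h)"
  shows "\<exists>ans. map fst ans = qs \<and> h @ [ans] \<in> set_pmf (run A v adv (Suc r))"
proof -
  obtain ans where ans: "ans \<in> set_pmf (noisy_answers v (adv h) qs)"
    using set_pmf_not_empty[of "noisy_answers v (adv h) qs"] by auto
  then have "h @ [ans] \<in> set_pmf (run A v adv (Suc r))"
    using assms by auto
  with set_noisy_answersD[OF ans] show ?thesis by blast
qed

text \<open>Carries the query budget, which is given for complete runs, over to the transcripts of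
  earlier rounds.\<close>

lemma set_run_extend:
  assumes "h \<in> set_pmf (run A v adv i)" "i \<le> r"
  shows "\<exists>h'. h' \<in> set_pmf (run A v adv r) \<and> length (concat h) \<le> length (concat h')"
  using assms(2)
proof (induction r rule: dec_induct)
  case base
  then show ?case using assms(1) by blast
next
  case (step r)
  then obtain h' where h': "h' \<in> set_pmf (run A v adv r)" "length (concat h) \<le> length (concat h')"
    by blast
  obtain qs where "qs \<in> set_pmf (next_batch A h')"
    using set_pmf_not_empty[of "next_batch A h'"] by auto
  from set_run_SucI[OF h'(1) this] obtain ans where "h' @ [ans] \<in> set_pmf (run A v adv (Suc r))"
    by blast
  moreover have "length (concat h) \<le> length (concat (h' @ [ans]))"
    using h'(2) by simp
  ultimately show ?case by blast
qed

lemma sum_count_list_le: "(\<Sum>m<n. count_list xs m) \<le> length xs"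
  for n :: nat
proof -
  have "(\<Sum>m<n. count_list xs m) = (\<Sum>m\<in>{..<n} \<inter> set xs. count_list xs m)"
    by (intro sum.mono_neutral_right) (auto simp: count_list_0_iff)
  also have "\<dots> \<le> (\<Sum>m\<in>set xs. count_list xs m)"
    by (intro sum_mono2) auto
  finally show ?thesis by (simp add: sum_count_set)
qed

text \<open>Markov's inequality for the counting measure on positions.\<close>

lemma card_frequent_le:
  fixes K :: real and n :: nat
  assumes "K > 0"
  shows "real (card {m. m < n \<and> K < real (count_list xs m)}) \<le> real (length xs) / K"
proof -
  let ?M = "{m. m < n \<and> K < real (count_list xs m)}"
  have "real (card ?M) * K = (\<Sum>m\<in>?M. K)"
    by simp
  also have "\<dots> \<le> (\<Sum>m\<in>?M. real (count_list xs m))"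
    by (intro sum_mono) auto
  also have "\<dots> \<le> (\<Sum>m<n. real (count_list xs m))"
    by (intro sum_mono2) auto
  also have "\<dots> \<le> real (length xs)"
    using sum_count_list_le[of xs n] by (simp flip: of_nat_sum)
  finally show ?thesis
    using assms by (simp add: pos_le_divide_eq)
qed

text \<open>The hit threshold of round \<open>i\<close> measured in units of \<open>log 3 b\<close>,
  the number of queries per element. In these units \<open>3 powr K\<close> turns into
  \<open>b powr growth b i\<close>.\<close>

fun growth :: "real \<Rightarrow> nat \<Rightarrow> real" where
  "growth b 0 = 0"
| "growth b (Suc i) = 12 * 2 ^ i * b powr growth b i"

text \<open>Passing from \<open>i\<close> to \<open>Suc i\<close> adds at most
  \<open>n / (12 * 2 ^ i)\<close>; the right side is the partial sum of this geometric
  series.\<close>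

lemma sum_prob_many_hits_le:
  fixes b :: real
  assumes budget: "\<And>m h. m < n \<Longrightarrow> h \<in> set_pmf (spike_run A m r) \<Longrightarrow>
      real (length (concat h)) \<le> real n * log 3 b"
    and "b > 1" and "i \<le> r"
  shows "(\<Sum>m<n. measure_pmf.prob (spike_run A m i) {h. growth b i * log 3 b < real (hits m h)})
      \<le> real n * (1 - 1 / 2 ^ i) / 6"
  using \<open>i \<le> r\<close>
proof (induction i)
  case 0
  then show ?case by (simp add: hits_def)
next
  case (Suc i)
  define K where "K j = growth b j * log 3 b" for j
  have lb: "log 3 b > 0" using \<open>b > 1\<close> by simp
  have Kpos: "K (Suc i) > 0" using lb \<open>b > 1\<close> by (simp add: K_def)
  have powK: "3 powr K j = b powr growth b j" for j
    using \<open>b > 1\<close> by (simp add: K_def mult.commute[of "growth b j"] flip: powr_powr)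
  define W where "W m = with_next (spike_run A m i) (next_batch A)" for m
  define S where "S m = {(h, qs). K (Suc i) < real (hits m h + count_list qs m)}" for m
  have "(\<Sum>m<n. measure_pmf.prob (spike_run A m (Suc i)) {h. K (Suc i) < real (hits m h)})
      = (\<Sum>m<n. measure_pmf.prob (W m) (S m))"
    by (simp only: prob_hits_Suc[where P = "\<lambda>k. K (Suc i) < real k"] W_def S_def)
  also have "\<dots> \<le> (\<Sum>m<n. measure_pmf.prob (spike_run A m i) {h. K i < real (hits m h)}
      + measure_pmf.prob (W m) {(h, qs). real (hits m h) \<le> K i \<and> (h, qs) \<in> S m})"
    unfolding W_def by (intro sum_mono prob_with_next_le_split)
  also have "\<dots> = (\<Sum>m<n. measure_pmf.prob (spike_run A m i) {h. K i < real (hits m h)})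
      + (\<Sum>m<n. measure_pmf.prob (W m) {(h, qs). real (hits m h) \<le> K i \<and> (h, qs) \<in> S m})"
    by (rule sum.distrib)
  also have "(\<Sum>m<n. measure_pmf.prob (W m) {(h, qs). real (hits m h) \<le> K i \<and> (h, qs) \<in> S m})
      \<le> 3 powr K i * (real n * log 3 b / K (Suc i))"
    unfolding W_def
  proof (rule sum_prob_with_next_le)
    fix m h qs
    assume m: "m < n" and "(h, qs) \<in> set_pmf (with_next (spike_run A m i) (next_batch A))"
    then have "h \<in> set_pmf (spike_run A m i)" "qs \<in> set_pmf (next_batch A h)"
      by (auto simp: with_next_def)
    \<comment> \<open>Complete the chosen batch by some possible answers and extend to
      \<open>r\<close> rounds: the budget then bounds the old queries together with the new
      batch.\<close>
    from set_run_SucI[OF this] obtain ans where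
      ans: "map fst ans = qs" "h @ [ans] \<in> set_pmf (spike_run A m (Suc i))" by blast
    from set_run_extend[OF ans(2) Suc.prems] obtain h' where
      "h' \<in> set_pmf (spike_run A m r)" "length (concat (h @ [ans])) \<le> length (concat h')" by blast
    with budget[OF m this(1)] have len: "real (length (map fst (concat h) @ qs)) \<le> real n * log 3 b"
      using ans(1) by auto
    have "real (card {l. l < n \<and> (h, qs) \<in> S l})
        \<le> real (length (map fst (concat h) @ qs)) / K (Suc i)"
      using card_frequent_le[OF Kpos, of n "map fst (concat h) @ qs"]
      by (simp add: S_def hits_def count_list_append)
    also have "\<dots> \<le> real n * log 3 b / K (Suc i)"
      using len Kpos by (intro divide_right_mono) auto
    finally show "real (card {l. l < n \<and> (h, qs) \<in> S l}) \<le> real n * log 3 b / K (Suc i)" .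
  qed (use lb Kpos in auto)
  \<comment> \<open>The threshold \<open>K (Suc i)\<close> contains both \<open>3 powr K i\<close>
    and \<open>log 3 b\<close> as factors, and these cancel.\<close>
  also have "3 powr K i * (real n * log 3 b / K (Suc i)) = real n / (12 * 2 ^ i)"
    unfolding powK using less_imp_neq[OF lb] \<open>b > 1\<close> by (simp add: K_def field_simps)
  finally have "(\<Sum>m<n. measure_pmf.prob (spike_run A m (Suc i)) {h. K (Suc i) < real (hits m h)})
      \<le> real n * (1 - 1 / 2 ^ i) / 6 + real n / (12 * 2 ^ i)"
    using Suc.IH Suc.prems unfolding K_def by linarith
  also have "\<dots> = real n * (1 - 1 / 2 ^ Suc i) / 6"
    by (simp add: field_simps)
  finally show ?case by (simp add: K_def)
qed

section \<open>From success to a bound on the size\<close>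

lemma max_elements_spike: "m < n \<Longrightarrow> max_elements n (spike m) = {m}"
proof -
  assume "m < n"
  then have "Max (spike m ` {..<n}) = 1"
    by (intro Max_eqI) (auto simp: spike_def split: if_splits intro: image_eqI[of _ _ m])
  with \<open>m < n\<close> show ?thesis
    by (auto simp: max_elements_def spike_def split: if_splits)
qed

text \<open>All spikes are arrangements of the single instance \<open>spike 0\<close>, so the
  guarantees of the algorithm apply to each of them.\<close>

lemma spike_transpose: "spike 0 \<circ> Transposition.transpose 0 m = spike m"
  by (auto simp: spike_def Transposition.transpose_def fun_eq_iff)

text \<open>Success summed over all positions is at least \<open>2 * n / 3\<close>. Runs with many
  hits account for at most \<open>n / 6\<close>, the remaining ones for at most
  \<open>b powr growth b r\<close>, which leaves \<open>n / 2\<close> below that power.\<close>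

lemma size_less_growth:
  fixes b :: real
  assumes "n \<ge> 1" "b > 1" and solves: "solves_max n (spike 0) r (2/3) A"
    and uses: "uses_at_most n (spike 0) r (real n * log 3 b) A"
  shows "real n < 3 * b powr growth b r"
proof -
  have perm: "Transposition.transpose 0 m permutes {..<n}" if "m < n" for m
    using that by (intro permutes_swap_id) auto
  define K where "K = growth b r * log 3 b"
  have powK: "3 powr K = b powr growth b r"
    using \<open>b > 1\<close> by (simp add: K_def mult.commute[of "growth b r"] flip: powr_powr)
  have budget: "real (length (concat h)) \<le> real n * log 3 b"
    if "m < n" "h \<in> set_pmf (spike_run A m r)" for m h
    using uses perm[OF that(1)] that(2) unfolding uses_at_most_def by (metis spike_transpose)
  define W where "W m = with_next (spike_run A m r) (result A)" for m
  define S where "S m = {(h :: transcript, y). y = m}" for m :: nat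
  have snd_W: "map_pmf snd (W m) = bind_pmf (spike_run A m r) (result A)" for m
    by (simp add: W_def with_next_def map_bind_pmf map_pmf_comp)
  have "real n * (2/3) = (\<Sum>m<n. 2/3)"
    by simp
  also have "\<dots> \<le> (\<Sum>m<n. measure_pmf.prob (W m) (S m))"
  proof (intro sum_mono)
    fix m assume "m \<in> {..<n}"
    then have m: "m < n" by simp
    have "2/3 \<le> measure_pmf.prob (bind_pmf (spike_run A m r) (result A)) {m}"
      using solves perm[OF m] unfolding solves_max_def
      by (metis spike_transpose max_elements_spike[OF m])
    also have "\<dots> = measure_pmf.prob (W m) (S m)"
      by (simp add: vimage_def S_def case_prod_unfold flip: snd_W)
    finally show "2/3 \<le> measure_pmf.prob (W m) (S m)" .
  qed
  also have "\<dots> \<le> (\<Sum>m<n. measure_pmf.prob (spike_run A m r) {h. K < real (hits m h)}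
      + measure_pmf.prob (W m) {(h, y). real (hits m h) \<le> K \<and> (h, y) \<in> S m})"
    unfolding W_def by (intro sum_mono prob_with_next_le_split)
  also have "\<dots> = (\<Sum>m<n. measure_pmf.prob (spike_run A m r) {h. K < real (hits m h)})
      + (\<Sum>m<n. measure_pmf.prob (W m) {(h, y). real (hits m h) \<le> K \<and> (h, y) \<in> S m})"
    by (rule sum.distrib)
  also have "\<dots> \<le> real n * (1 - 1 / 2 ^ r) / 6 + 3 powr K * 1"
    unfolding W_def K_def
  proof (intro add_mono sum_prob_many_hits_le[where r = r] sum_prob_with_next_le)
    \<comment> \<open>An output names only one position, hence \<open>d = 1\<close>.\<close>
    fix h and y
    have "card {l. l < n \<and> (h, y) \<in> S l} \<le> card {y}"
      by (intro card_mono) (auto simp: S_def)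
    then show "real (card {l. l < n \<and> (h, y) \<in> S l}) \<le> 1" by simp
  qed (use budget \<open>b > 1\<close> in auto)
  also have "\<dots> \<le> real n / 6 + b powr growth b r"
    by (simp add: powK divide_right_mono mult_left_le)
  finally have "real n \<le> 2 * b powr growth b r" by simp
  also have "\<dots> < 3 * b powr growth b r" using \<open>b > 1\<close> by simp
  finally show ?thesis .
qed

section \<open>Iterated logarithms\<close>

text \<open>Allowing any \<open>i\<close> up to \<open>k\<close> gives a relation with a recursion
  in \<open>k\<close> and monotone in \<open>a\<close>. A witness also settles that the
  \<open>LEAST\<close> in \<open>log_star\<close> exists.\<close>

definition log_star_le :: "real \<Rightarrow> real \<Rightarrow> nat \<Rightarrow> bool" where
  "log_star_le b a k \<longleftrightarrow> (\<exists>i\<le>k. (log b ^^ i) a \<le> 0)"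

lemma log_star_le_0: "log_star_le b a 0 \<longleftrightarrow> a \<le> 0"
  by (simp add: log_star_le_def)

lemma log_star_le_Suc: "log_star_le b a (Suc k) \<longleftrightarrow> a \<le> 0 \<or> log_star_le b (log b a) k"
proof -
  have "(\<exists>i\<le>Suc k. (log b ^^ i) a \<le> 0) \<longleftrightarrow> a \<le> 0 \<or> (\<exists>i\<le>k. (log b ^^ Suc i) a \<le> 0)"
    by (metis Suc_le_mono funpow_0 le0 not0_implies_Suc)
  then show ?thesis
    by (simp add: log_star_le_def funpow_swap1)
qed

text \<open>Logarithms are compared only for positive arguments: once \<open>a\<close> is at most 0
  its sequence has already stopped.\<close>

lemma log_star_le_mono:
  assumes "b > 1" "a \<le> a'" "log_star_le b a' k"
  shows "log_star_le b a k"
  using assms(2,3)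
proof (induction k arbitrary: a a')
  case 0
  then show ?case by (simp add: log_star_le_0)
next
  case (Suc k)
  show ?case
  proof (cases "a \<le> 0")
    case False
    with Suc.prems have "log b a \<le> log b a'" "log_star_le b (log b a') k"
      using \<open>b > 1\<close> by (auto simp: log_star_le_Suc)
    then show ?thesis using Suc.IH by (auto simp: log_star_le_Suc)
  qed (simp add: log_star_le_Suc)
qed

lemma log_star_le_powrI:
  assumes "b > 1" "a \<le> b powr s" "log_star_le b s k"
  shows "log_star_le b a (Suc k)"
proof (cases "a \<le> 0")
  case False
  then have "log b a \<le> s"
    using assms(1,2) by (simp add: log_le_iff)
  then show ?thesis
    using log_star_le_mono[OF assms(1) _ assms(3)] by (simp add: log_star_le_Suc)
qed (simp add: log_star_le_Suc)

lemma log_star_leD: "log_star_le b a k \<Longrightarrow> log_star b a \<le> k"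
  unfolding log_star_le_def log_star_def by (meson Least_le order_trans)

text \<open>
  The summand \<open>i + 3\<close> makes one logarithm enough to step down, as
  \<open>12 * 2 ^ i + (i + 4) \<le> 4 ^ (i + 3)\<close>.
\<close>

lemma log_star_le_growth:
  fixes b :: real
  assumes "b \<ge> 4"
  shows "log_star_le b (growth b i + real i + 3) (i + 2)"
proof (induction i)
  case 0
  \<comment> \<open>Two steps suffice for 3, because \<open>3 \<le> b powr 1\<close> and
    \<open>1 \<le> b powr 0\<close>.\<close>
  have "log_star_le b 0 0" by (simp add: log_star_le_0)
  with assms have "log_star_le b 1 (Suc 0)"
    using log_star_le_powrI[of b 1 0 0] by simp
  with assms have "log_star_le b 3 (Suc (Suc 0))"
    using log_star_le_powrI[of b 3 1 "Suc 0"] by simp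
  then show ?case by (simp add: numeral_2_eq_2)
next
  case (Suc i)
  have lin: "real i + 4 \<le> 4 * 2 ^ i" by (induction i) auto
  have growth_nonneg: "growth b i \<ge> 0" by (cases i) auto
  then have one: "1 \<le> b powr growth b i" using assms by (simp add: ge_one_powr_ge_zero)
  have "growth b (Suc i) + real (Suc i) + 3 \<le> 12 * 2 ^ i * b powr growth b i + 4 * 2 ^ i * b powr growth b i"
    using order_trans[OF lin, of "4 * 2 ^ i * b powr growth b i"] one by simp
  also have "\<dots> = 16 * 2 ^ i * b powr growth b i"
    by simp
  also have "\<dots> \<le> 4 ^ (i + 3) * b powr growth b i"
  proof (rule mult_right_mono)
    have "(2::real) ^ i \<le> 4 ^ i" by (intro power_mono) auto
    also have "\<dots> \<le> 4 * (4::real) ^ i" by simp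
    finally show "16 * (2::real) ^ i \<le> 4 ^ (i + 3)" by (simp add: power_add)
  qed simp
  \<comment> \<open>As \<open>b \<ge> 4\<close>, the prefactor is absorbed into \<open>i + 3\<close>
    further powers of \<open>b\<close>, exactly the summand in the induction hypothesis.\<close>
  also have "\<dots> \<le> b ^ (i + 3) * b powr growth b i"
    using assms by (intro mult_right_mono power_mono) auto
  also have "\<dots> = b powr (growth b i + real i + 3)"
    using assms by (simp add: powr_realpow[symmetric] powr_add[symmetric] add_ac)
  finally show ?case
    using log_star_le_powrI[OF _ _ Suc] assms by simp
qed

theorem mainTheorem2:
  "\<exists>C::real. \<forall>n\<ge>1. \<exists>x :: nat \<Rightarrow> real.
     \<forall>(A :: value_alg) (b :: real) (r :: nat).
       alg_on n A \<longrightarrow> b \<ge> 4 \<longrightarrow>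
       solves_max n x r (2/3) A \<longrightarrow>
       uses_at_most n x r (real n * log 3 b) A \<longrightarrow>
       real r \<ge> real (log_star b (real n)) - C"
proof (intro exI allI impI)
  fix n r :: nat and A :: value_alg and b :: real
  assume "n \<ge> 1" and b: "b \<ge> 4" and "solves_max n (spike 0) r (2/3) A"
    and "uses_at_most n (spike 0) r (real n * log 3 b) A"
  then have "real n < 3 * b powr growth b r"
    by (intro size_less_growth) auto
  \<comment> \<open>The factor 3 costs one unit in the exponent, which the slack
    \<open>r + 3\<close> covers.\<close>
  also have "\<dots> \<le> b powr 1 * b powr growth b r"
    using b by (intro mult_right_mono) auto
  also have "\<dots> = b powr (1 + growth b r)"
    by (rule powr_add[symmetric])
  also have "\<dots> \<le> b powr (growth b r + real r + 3)"
    using b by (intro powr_mono) auto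
  \<comment> \<open>The constant is 3: two steps from the base case of
    \<open>log_star_le_growth\<close> and one for the power of \<open>b\<close> above
    \<open>n\<close>.\<close>
  finally have "log_star_le b (real n) (Suc (r + 2))"
    using log_star_le_powrI[OF _ _ log_star_le_growth[OF b]] b by simp
  then have "log_star b (real n) \<le> r + 3"
    using log_star_leD by fastforce
  then show "real (log_star b (real n)) - 3 \<le> real r" by simp
qed

end
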